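(* Let $a<b$ be real numbers, let $f=f(x,y,z):[a,b]\times\mathbb{R}\times\mathbb{R}\to\mathbb{R}$ satisfy $f\in C^2$ and $f_{yz}\in C^1$, and let $y_0\in C^2[a,b]$. Consider $$\Phi(y)=\int_a^b f(x,y(x),y'(x))\,dx,\qquad y\in C^1[a,b],\ y(a)=y_0(a),\ y(b)=y_0(b).$$ Assume the Euler--Lagrange equation at $y_0$: $$f_y(x,y_0(x),y_0'(x))-\frac{d}{dx}\bigl[f_z(x,y_0(x),y_0'(x))\bigr]=0\qquad(a\le x\le b).$$ Put $$p:=\min_{a\le x\le b} f_{zz}(x,y_0(x),y_0'(x)),\qquad q:=\min_{a\le x\le b}\Bigl[f_{yy}(x,y_0(x),y_0'(x))-\frac{d}{dx}\bigl(f_{yz}(x,y_0(x),y_0'(x))\bigr)\Bigr].$$ Then, under the boundary conditions $y(a)=y_0(a)$, $y(b)=y_0(b)$: 1) if $p>0$ and $q\ge0$, then $\Phi$ attains a strong local minimum at $y_0$ (without any restriction on the length of $[a,b]$); 2) if $p>0$, $q<0$ and $$b-a<\frac{\pi}{4}\sqrt{\frac{p}{|q|}},$$ then $\Phi$ attains a strong local minimum at $y_0$ as well.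
   Context: Subscripts denote partial derivatives. "Strong local minimum at $y_0$" means a strict local minimum in $C^1[a,b]$: there is $\delta>0$ such that $\Phi(y)>\Phi(y_0)$ for every $y\in C^1[a,b]$ with $y(a)=y_0(a)$, $y(b)=y_0(b)$, $y\neq y_0$ and $\|y-y_0\|_{C^1[a,b]}<\delta$, where $\|u\|_{C^1[a,b]}=\max|u|+\max|u'|$. *)

theory Defs
  imports "HOL-Analysis.Analysis"
begin

text \<open>
  Functions on \<open>[a,b]\<close> and on \<open>[a,b] \<times> \<real> \<times> \<real>\<close> are represented by total functions whose values
  outside these sets are irrelevant: derivatives in the variable \<open>x\<close> are taken within \<open>{a..b}\<close>,
  hence one-sided at the endpoints.
\<close>

definition ddx :: "real \<Rightarrow> real \<Rightarrow> (real \<Rightarrow> real) \<Rightarrow> real \<Rightarrow> real"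
  where "ddx a b u x = vector_derivative u (at x within {a..b})"

primrec Ck_interval :: "nat \<Rightarrow> real \<Rightarrow> real \<Rightarrow> (real \<Rightarrow> real) \<Rightarrow> bool"
  where
    "Ck_interval 0 a b u \<longleftrightarrow> continuous_on {a..b} u"
  | "Ck_interval (Suc k) a b u \<longleftrightarrow> u differentiable_on {a..b} \<and> Ck_interval k a b (ddx a b u)"

definition partial_x ::
    "real \<Rightarrow> real \<Rightarrow> (real \<Rightarrow> real \<Rightarrow> real \<Rightarrow> real) \<Rightarrow> real \<Rightarrow> real \<Rightarrow> real \<Rightarrow> real"
  where "partial_x a b f x y z = ddx a b (\<lambda>t. f t y z) x"

definition partial_y :: "(real \<Rightarrow> real \<Rightarrow> real \<Rightarrow> real) \<Rightarrow> real \<Rightarrow> real \<Rightarrow> real \<Rightarrow> real"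
  where "partial_y f x y z = deriv (\<lambda>t. f x t z) y"

definition partial_z :: "(real \<Rightarrow> real \<Rightarrow> real \<Rightarrow> real) \<Rightarrow> real \<Rightarrow> real \<Rightarrow> real \<Rightarrow> real"
  where "partial_z f x y z = deriv (\<lambda>t. f x y t) z"

text \<open>
  Class \<open>C\<^sup>k\<close> on \<open>[a,b] \<times> \<real> \<times> \<real>\<close>: all partial derivatives up to order \<open>k\<close>, in every order of
  differentiation, exist and are jointly continuous on this set.
\<close>

primrec Ck_slab ::
    "nat \<Rightarrow> real \<Rightarrow> real \<Rightarrow> (real \<Rightarrow> real \<Rightarrow> real \<Rightarrow> real) \<Rightarrow> bool"
  where
    "Ck_slab 0 a b f \<longleftrightarrow> continuous_on ({a..b} \<times> UNIV \<times> UNIV) (\<lambda>(x, y, z). f x y z)"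
  | "Ck_slab (Suc k) a b f \<longleftrightarrow>
       continuous_on ({a..b} \<times> UNIV \<times> UNIV) (\<lambda>(x, y, z). f x y z) \<and>
       (\<forall>x\<in>{a..b}. \<forall>y z.
          (\<lambda>t. f t y z) differentiable (at x within {a..b}) \<and>
          (\<lambda>t. f x t z) differentiable (at y) \<and>
          (\<lambda>t. f x y t) differentiable (at z)) \<and>
       Ck_slab k a b (partial_x a b f) \<and>
       Ck_slab k a b (partial_y f) \<and>
       Ck_slab k a b (partial_z f)"

text \<open>
  Attained extrema over \<open>[a,b]\<close>; the library's \<open>Min\<close> and \<open>Max\<close> apply to finite sets only.
\<close>

definition min_on :: "real \<Rightarrow> real \<Rightarrow> (real \<Rightarrow> real) \<Rightarrow> real"
  where "min_on a b g = (LEAST v. v \<in> g ` {a..b})"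

definition max_on :: "real \<Rightarrow> real \<Rightarrow> (real \<Rightarrow> real) \<Rightarrow> real"
  where "max_on a b g = (GREATEST v. v \<in> g ` {a..b})"

definition C1_norm :: "real \<Rightarrow> real \<Rightarrow> (real \<Rightarrow> real) \<Rightarrow> real"
  where "C1_norm a b u = max_on a b (\<lambda>x. \<bar>u x\<bar>) + max_on a b (\<lambda>x. \<bar>ddx a b u x\<bar>)"

definition functional ::
    "real \<Rightarrow> real \<Rightarrow> (real \<Rightarrow> real \<Rightarrow> real \<Rightarrow> real) \<Rightarrow> (real \<Rightarrow> real) \<Rightarrow> real"
  where "functional a b f y = integral {a..b} (\<lambda>x. f x (y x) (ddx a b y x))"

text \<open>
  Strict local minimum in \<open>C\<^sup>1[a,b]\<close> with fixed boundary values; distinctness of \<open>y\<close> and \<open>y0\<close> means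
  distinctness as functions on \<open>[a,b]\<close>.
\<close>

definition strong_local_min ::
    "real \<Rightarrow> real \<Rightarrow> ((real \<Rightarrow> real) \<Rightarrow> real) \<Rightarrow> (real \<Rightarrow> real) \<Rightarrow> bool"
  where "strong_local_min a b \<Phi> y0 \<longleftrightarrow>
    (\<exists>\<delta>>0. \<forall>y. Ck_interval 1 a b y \<and> y a = y0 a \<and> y b = y0 b \<and>
       (\<exists>x\<in>{a..b}. y x \<noteq> y0 x) \<and> C1_norm a b (\<lambda>x. y x - y0 x) < \<delta> \<longrightarrow> \<Phi> y > \<Phi> y0)"

end

theory Submission
  imports Defs
begin

text \<open>
  Write \<open>y = y0 + h\<close> with \<open>h a = h b = 0\<close>, and let all partial derivatives of \<open>f\<close> be taken along the
  curve \<open>(x, y0 x, y0' x)\<close>. Uniform continuity of the second derivatives near this compact curve gives,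
  for \<open>h\<close> small in \<open>C\<^sup>1\<close>, the pointwise bound
  \<open>f(x, y, y') \<ge> f + (f\<^sub>y h + f\<^sub>z h') + (f\<^sub>y\<^sub>y h\<^sup>2 + 2 f\<^sub>y\<^sub>z h h' + f\<^sub>z\<^sub>z h'\<^sup>2) / 2 - \<epsilon> (h\<^sup>2 + h'\<^sup>2)\<close>
  (\<open>taylor_lower_bound_near_curve\<close>). By the Euler-Lagrange equation the linear part is the derivative
  of \<open>f\<^sub>z h\<close>, so its integral vanishes. Likewise \<open>2 f\<^sub>y\<^sub>z h h' = (f\<^sub>y\<^sub>z h\<^sup>2)' - (f\<^sub>y\<^sub>z)' h\<^sup>2\<close>, which leaves
  in the quadratic part the integral of \<open>(f\<^sub>y\<^sub>y - (f\<^sub>y\<^sub>z)') h\<^sup>2 + f\<^sub>z\<^sub>z h'\<^sup>2 \<ge> q h\<^sup>2 + p h'\<^sup>2\<close>.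

  It remains to see that the integral of \<open>q h\<^sup>2 + p h'\<^sup>2\<close> dominates a positive multiple of the integral
  of \<open>h\<^sup>2 + h'\<^sup>2\<close>, since \<open>\<epsilon>\<close> can then be taken small enough for the error to be absorbed. The
  inequality \<open>\<integral> h'\<^sup>2 \<ge> c\<^sup>2 \<integral> h\<^sup>2\<close> for \<open>c (b - a) < \<pi>\<close> (\<open>wirtinger\<close>) reduces this to
  \<open>p > 0\<close> and \<open>p c\<^sup>2 + q > 0\<close>. For \<open>c = \<pi> / (4 (b - a))\<close> that condition is automatic when \<open>q \<ge> 0\<close>, and when \<open>q < 0\<close>
  it is exactly the bound on \<open>b - a\<close>.
\<close>

section \<open>Derivatives and extrema on an interval\<close>

lemma has_ddx:
  assumes "u differentiable (at x within {a..b})"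
  shows "(u has_real_derivative ddx a b u x) (at x within {a..b})"
  using assms unfolding ddx_def has_real_derivative_iff_has_vector_derivative
  by (simp add: vector_derivative_works)

lemma ddx_eqI:
  assumes "a < b" "x \<in> {a..b}" "(u has_real_derivative d) (at x within {a..b})"
  shows "ddx a b u x = d"
  using assms unfolding ddx_def has_real_derivative_iff_has_vector_derivative
  by (intro vector_derivative_within_closed_interval)

lemma min_on_le:
  assumes "continuous_on {a..b} g" "x \<in> {a..b}"
  shows "min_on a b g \<le> g x"
proof -
  obtain m where m: "m \<in> {a..b}" "\<And>t. t \<in> {a..b} \<Longrightarrow> g m \<le> g t"
    using continuous_attains_inf[OF compact_Icc _ assms(1)] assms(2) by blast
  have "min_on a b g = g m"
    unfolding min_on_def by (rule Least_equality) (use m in auto)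
  then show ?thesis using m(2)[OF assms(2)] by simp
qed

lemma le_max_on:
  assumes "continuous_on {a..b} g" "x \<in> {a..b}"
  shows "g x \<le> max_on a b g"
proof -
  obtain m where m: "m \<in> {a..b}" "\<And>t. t \<in> {a..b} \<Longrightarrow> g t \<le> g m"
    using continuous_attains_sup[OF compact_Icc _ assms(1)] assms(2) by blast
  have "max_on a b g = g m"
    unfolding max_on_def by (rule Greatest_equality) (use m in auto)
  then show ?thesis using m(2)[OF assms(2)] by simp
qed

lemma C1_norm_bounds:
  assumes "continuous_on {a..b} u" "continuous_on {a..b} (ddx a b u)" "x \<in> {a..b}"
  shows "\<bar>u x\<bar> \<le> C1_norm a b u" "\<bar>ddx a b u x\<bar> \<le> C1_norm a b u"
proof -
  have "\<bar>u x\<bar> \<le> max_on a b (\<lambda>x. \<bar>u x\<bar>)"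
    by (rule le_max_on[OF continuous_on_rabs[OF assms(1)] assms(3)])
  moreover have "\<bar>ddx a b u x\<bar> \<le> max_on a b (\<lambda>x. \<bar>ddx a b u x\<bar>)"
    by (rule le_max_on[OF continuous_on_rabs[OF assms(2)] assms(3)])
  ultimately show "\<bar>u x\<bar> \<le> C1_norm a b u" "\<bar>ddx a b u x\<bar> \<le> C1_norm a b u"
    unfolding C1_norm_def by linarith+
qed

text \<open>
  A mean value theorem that is indifferent to the order of the two points and covers one-sided
  derivatives; it is applied both with \<open>S = {a..b}\<close> and with \<open>S = UNIV\<close>.
\<close>

lemma mvt_convex:
  fixes g g' :: "real \<Rightarrow> real"
  assumes "convex S" "s \<in> S" "t \<in> S"
    and "\<And>x. x \<in> S \<Longrightarrow> (g has_real_derivative g' x) (at x within S)"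
  shows "\<exists>\<xi>\<in>S. \<bar>\<xi> - t\<bar> \<le> \<bar>s - t\<bar> \<and> g s - g t = g' \<xi> * (s - t)"
proof -
  have *: "\<exists>\<xi>\<in>S. u \<le> \<xi> \<and> \<xi> \<le> v \<and> g v - g u = g' \<xi> * (v - u)"
    if "u \<in> S" "v \<in> S" "u < v" for u v
  proof -
    have sub: "{u..v} \<subseteq> S"
      using convex_contains_segment assms(1) that closed_segment_eq_real_ivl by (metis less_imp_le)
    have "(g has_derivative (*) (g' x)) (at x within {u..v})" if "u \<le> x" "x \<le> v" for x
      using DERIV_subset[OF assms(4) sub] sub that by (auto simp: has_field_derivative_def)
    from mvt_simple[OF that(3) this]
    obtain \<xi> where "\<xi> \<in> {u<..<v}" "g v - g u = g' \<xi> * (v - u)" by auto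
    then show ?thesis using sub by (intro bexI[of _ \<xi>]) auto
  qed
  consider "s < t" | "s = t" | "t < s" by linarith
  then show ?thesis
  proof cases
    case 1
    with *[OF assms(2,3)] show ?thesis by (force simp: algebra_simps)
  next
    case 2
    with assms(2) show ?thesis by auto
  next
    case 3
    with *[OF assms(3,2)] show ?thesis by force
  qed
qed

lemma taylor_order2:
  fixes g g1 g2 :: "real \<Rightarrow> real"
  assumes "\<And>t. (g has_real_derivative g1 t) (at t)" "\<And>t. (g1 has_real_derivative g2 t) (at t)"
  shows "\<exists>s. \<bar>s - c\<bar> \<le> \<bar>h\<bar> \<and> g (c + h) = g c + g1 c * h + g2 s / 2 * h\<^sup>2"
proof (cases "h = 0")
  case False
  define diff where "diff = (\<lambda>m::nat. if m = 0 then g else if m = 1 then g1 else g2)"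
  have "\<exists>t. (if c + h < c then c + h < t \<and> t < c else c < t \<and> t < c + h) \<and>
      g (c + h) = (\<Sum>m<2. diff m c / fact m * (c + h - c) ^ m) + diff 2 t / fact 2 * (c + h - c) ^ 2"
    by (rule Taylor[where a = "c - \<bar>h\<bar>" and b = "c + \<bar>h\<bar>"])
      (use False assms in \<open>auto simp: diff_def less_2_cases_iff\<close>)
  then obtain t where t: "if c + h < c then c + h < t \<and> t < c else c < t \<and> t < c + h"
    and eq: "g (c + h) = (\<Sum>m<2. diff m c / fact m * h ^ m) + diff 2 t / fact 2 * h ^ 2" by auto
  have "g (c + h) = g c + g1 c * h + g2 t / 2 * h\<^sup>2"
    unfolding eq by (simp add: diff_def numeral_2_eq_2)
  moreover have "\<bar>t - c\<bar> \<le> \<bar>h\<bar>" using t by (auto split: if_splits)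
  ultimately show ?thesis by blast
qed (auto intro: exI[of _ c])

section \<open>Differential calculus along a curve in the slab\<close>

lemma slab_partial_derivatives:
  assumes "Ck_slab (Suc k) a b F" "x \<in> {a..b}"
  shows "((\<lambda>t. F t y z) has_real_derivative partial_x a b F x y z) (at x within {a..b})"
    and "((\<lambda>t. F x t z) has_real_derivative partial_y F x y z) (at y)"
    and "((\<lambda>t. F x y t) has_real_derivative partial_z F x y z) (at z)"
  using assms has_ddx[of "\<lambda>t. F t y z" x a b]
  by (auto simp: partial_x_def partial_y_def partial_z_def DERIV_deriv_iff_real_differentiable)

lemma slab_continuous: "Ck_slab k a b F \<Longrightarrow> continuous_on ({a..b} \<times> UNIV \<times> UNIV) (\<lambda>(x, y, z). F x y z)"
  by (cases k) auto

lemma continuous_on_slab_curve: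
  fixes F :: "real \<Rightarrow> real \<Rightarrow> real \<Rightarrow> real"
  assumes "continuous_on ({a..b} \<times> UNIV \<times> UNIV) (\<lambda>(x, y, z). F x y z)"
    and "continuous_on {a..b} u" "continuous_on {a..b} v"
  shows "continuous_on {a..b} (\<lambda>x. F x (u x) (v x))"
proof -
  have "continuous_on {a..b} (\<lambda>x. (x, u x, v x))"
    using assms by (intro continuous_intros)
  from continuous_on_compose2[OF assms(1) this] show ?thesis by auto
qed

text \<open>
  The pairs \<open>(h, k)\<close> of deviations from the curve may be confined to a square. In the coordinates
  \<open>(x, h, k)\<close> the neighbourhood of the curve is then compact, so that uniform continuity applies.
\<close>

lemma uniform_continuity_near_curve:
  fixes F :: "real \<Rightarrow> real \<Rightarrow> real \<Rightarrow> real"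
  assumes F: "continuous_on ({a..b} \<times> UNIV \<times> UNIV) (\<lambda>(x, y, z). F x y z)"
    and u: "continuous_on {a..b} u" and v: "continuous_on {a..b} v" and "\<epsilon> > 0"
  shows "\<exists>\<delta>>0. \<forall>x\<in>{a..b}. \<forall>y z. \<bar>y - u x\<bar> < \<delta> \<and> \<bar>z - v x\<bar> < \<delta> \<longrightarrow>
           \<bar>F x y z - F x (u x) (v x)\<bar> < \<epsilon>"
proof -
  let ?K = "{a..b} \<times> {-1..1} \<times> {-1..1::real}"
  let ?G = "\<lambda>(x, h, k). F x (u x + h) (v x + k)"
  have "continuous_on ?K (\<lambda>w. (fst w, u (fst w) + fst (snd w), v (fst w) + snd (snd w)))"
    by (intro continuous_intros continuous_on_compose2[OF u] continuous_on_compose2[OF v]) auto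
  from continuous_on_compose2[OF F this] have "continuous_on ?K ?G"
    by (force simp: case_prod_beta)
  then have "uniformly_continuous_on ?K ?G"
    by (intro compact_uniformly_continuous compact_Times compact_Icc)
  then obtain d where d: "d > 0" and
    D: "\<And>w w'. w \<in> ?K \<Longrightarrow> w' \<in> ?K \<Longrightarrow> dist w' w < d \<Longrightarrow> dist (?G w') (?G w) < \<epsilon>"
    using \<open>\<epsilon> > 0\<close> by (rule uniformly_continuous_onE) blast
  have "\<bar>F x y z - F x (u x) (v x)\<bar> < \<epsilon>"
    if "x \<in> {a..b}" "\<bar>y - u x\<bar> < min 1 (d / 2)" "\<bar>z - v x\<bar> < min 1 (d / 2)" for x y z
  proof -
    have "dist (x, y - u x, z - v x) (x, 0, 0) \<le> \<bar>y - u x\<bar> + \<bar>z - v x\<bar>"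
      by (simp add: dist_Pair_Pair dist_real_def sqrt_sum_squares_le_sum_abs)
    also have "\<dots> < d" using that by auto
    finally have "dist (?G (x, y - u x, z - v x)) (?G (x, 0, 0)) < \<epsilon>"
      using that by (intro D) auto
    then show ?thesis by (simp add: dist_real_def)
  qed
  then show ?thesis using d by (intro exI[of _ "min 1 (d / 2)"]) auto
qed

text \<open>
  Passing from \<open>(t, u t, v t)\<close> to \<open>(s, u s, v s)\<close> one coordinate at a time writes the increment of \<open>F\<close>
  as three increments in a single variable. The mean value theorem turns each into a partial derivative
  at an intermediate point, and these points tend to \<open>(t, u t, v t)\<close>, where the partial derivatives
  are continuous.
\<close>

lemma chain_rule_slab:
  assumes F: "Ck_slab 1 a b F" and t: "t \<in> {a..b}"
    and u: "(u has_real_derivative u') (at t within {a..b})"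
    and v: "(v has_real_derivative v') (at t within {a..b})"
  shows "((\<lambda>s. F s (u s) (v s)) has_real_derivative
            partial_x a b F t (u t) (v t) + partial_y F t (u t) (v t) * u'
            + partial_z F t (u t) (v t) * v') (at t within {a..b})"
proof -
  let ?f = "at t within {a..b}"
  have F1: "Ck_slab (Suc 0) a b F" using F by simp
  note D = slab_partial_derivatives[OF F1]
  have C: "continuous_on ({a..b} \<times> UNIV \<times> UNIV) (\<lambda>(x, y, z). partial_x a b F x y z)"
    "continuous_on ({a..b} \<times> UNIV \<times> UNIV) (\<lambda>(x, y, z). partial_y F x y z)"
    "continuous_on ({a..b} \<times> UNIV \<times> UNIV) (\<lambda>(x, y, z). partial_z F x y z)"
    using F1 by auto
  have ev: "\<forall>\<^sub>F s in ?f. s \<in> {a..b} \<and> s \<noteq> t"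
    by (auto simp: eventually_at_filter)
  have id_lim: "((\<lambda>s. s) \<longlongrightarrow> t) ?f" by (rule tendsto_ident_at)
  have u_lim: "(u \<longlongrightarrow> u t) ?f" and v_lim: "(v \<longlongrightarrow> v t) ?f"
    using DERIV_continuous[OF u] DERIV_continuous[OF v] by (simp_all add: continuous_within)
  have squeeze: "(\<eta> \<longlongrightarrow> g t) ?f"
    if "(g \<longlongrightarrow> g t) ?f" "\<forall>s\<in>{a..b}. \<bar>\<eta> s - g t\<bar> \<le> \<bar>g s - g t\<bar>" for g \<eta> :: "real \<Rightarrow> real"
  proof -
    have "((\<lambda>s. g s - g t) \<longlongrightarrow> 0) ?f" using that(1) by (rule LIM_zero)
    moreover have "\<forall>\<^sub>F s in ?f. norm (\<eta> s - g t) \<le> norm (g s - g t)"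
      using ev by eventually_elim (use that(2) in auto)
    ultimately have "((\<lambda>s. \<eta> s - g t) \<longlongrightarrow> 0) ?f"
      by (rule Lim_null_comparison[rotated, OF tendsto_norm_zero])
    then show ?thesis by (rule LIM_zero_cancel)
  qed
  have lim: "((\<lambda>s. A (\<xi> s) (\<eta> s) (\<zeta> s)) \<longlongrightarrow> A t (u t) (v t)) ?f"
    if A: "continuous_on ({a..b} \<times> UNIV \<times> UNIV) (\<lambda>(x, y, z). A x y z)"
      and "(\<xi> \<longlongrightarrow> t) ?f" "(\<eta> \<longlongrightarrow> u t) ?f" "(\<zeta> \<longlongrightarrow> v t) ?f" "\<forall>s\<in>{a..b}. \<xi> s \<in> {a..b}"
    for A :: "real \<Rightarrow> real \<Rightarrow> real \<Rightarrow> real" and \<xi> \<eta> \<zeta>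
  proof -
    have "((\<lambda>s. (\<xi> s, \<eta> s, \<zeta> s)) \<longlongrightarrow> (t, u t, v t)) ?f"
      by (intro tendsto_Pair that)
    moreover have "\<forall>\<^sub>F s in ?f. (\<xi> s, \<eta> s, \<zeta> s) \<in> {a..b} \<times> UNIV \<times> UNIV"
      using ev by eventually_elim (use that(5) in auto)
    ultimately show ?thesis
      using continuous_on_tendsto_compose[OF A] t by fastforce
  qed
  have "\<forall>s\<in>{a..b}. \<exists>\<xi>\<in>{a..b}. \<bar>\<xi> - t\<bar> \<le> \<bar>s - t\<bar> \<and>
      F s (u s) (v s) - F t (u s) (v s) = partial_x a b F \<xi> (u s) (v s) * (s - t)"
    by (intro ballI mvt_convex D t convex_closed_interval) auto
  then obtain \<xi> where \<xi>: "\<forall>s\<in>{a..b}. \<xi> s \<in> {a..b} \<and> \<bar>\<xi> s - t\<bar> \<le> \<bar>s - t\<bar> \<and>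
      F s (u s) (v s) - F t (u s) (v s) = partial_x a b F (\<xi> s) (u s) (v s) * (s - t)"
    by metis
  have "\<forall>s. \<exists>\<eta>\<in>UNIV. \<bar>\<eta> - u t\<bar> \<le> \<bar>u s - u t\<bar> \<and>
      F t (u s) (v s) - F t (u t) (v s) = partial_y F t \<eta> (v s) * (u s - u t)"
    by (intro allI mvt_convex D t) auto
  then obtain \<eta> where \<eta>: "\<forall>s. \<bar>\<eta> s - u t\<bar> \<le> \<bar>u s - u t\<bar> \<and>
      F t (u s) (v s) - F t (u t) (v s) = partial_y F t (\<eta> s) (v s) * (u s - u t)"
    by metis
  have "\<forall>s. \<exists>\<zeta>\<in>UNIV. \<bar>\<zeta> - v t\<bar> \<le> \<bar>v s - v t\<bar> \<and>
      F t (u t) (v s) - F t (u t) (v t) = partial_z F t (u t) \<zeta> * (v s - v t)"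
    by (intro allI mvt_convex D t) auto
  then obtain \<zeta> where \<zeta>: "\<forall>s. \<bar>\<zeta> s - v t\<bar> \<le> \<bar>v s - v t\<bar> \<and>
      F t (u t) (v s) - F t (u t) (v t) = partial_z F t (u t) (\<zeta> s) * (v s - v t)"
    by metis
  have \<xi>_lim: "(\<xi> \<longlongrightarrow> t) ?f" by (rule squeeze[OF id_lim]) (use \<xi> in blast)
  have \<eta>_lim: "(\<eta> \<longlongrightarrow> u t) ?f" by (rule squeeze[OF u_lim]) (use \<eta> in blast)
  have \<zeta>_lim: "(\<zeta> \<longlongrightarrow> v t) ?f" by (rule squeeze[OF v_lim]) (use \<zeta> in blast)
  have quotient_lim: "((\<lambda>s. partial_x a b F (\<xi> s) (u s) (v s)
        + partial_y F t (\<eta> s) (v s) * ((u s - u t) / (s - t))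
        + partial_z F t (u t) (\<zeta> s) * ((v s - v t) / (s - t))) \<longlongrightarrow>
      partial_x a b F t (u t) (v t) + partial_y F t (u t) (v t) * u'
        + partial_z F t (u t) (v t) * v') ?f"
  proof (intro tendsto_add tendsto_mult)
    show "((\<lambda>s. (u s - u t) / (s - t)) \<longlongrightarrow> u') ?f" "((\<lambda>s. (v s - v t) / (s - t)) \<longlongrightarrow> v') ?f"
      using u v by (simp_all add: has_field_derivative_iff)
    show "((\<lambda>s. partial_x a b F (\<xi> s) (u s) (v s)) \<longlongrightarrow> partial_x a b F t (u t) (v t)) ?f"
      using \<xi> by (intro lim[OF C(1) \<xi>_lim u_lim v_lim]) auto
    show "((\<lambda>s. partial_y F t (\<eta> s) (v s)) \<longlongrightarrow> partial_y F t (u t) (v t)) ?f"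
      using t by (intro lim[OF C(2) tendsto_const \<eta>_lim v_lim]) auto
    show "((\<lambda>s. partial_z F t (u t) (\<zeta> s)) \<longlongrightarrow> partial_z F t (u t) (v t)) ?f"
      using t by (intro lim[OF C(3) tendsto_const tendsto_const \<zeta>_lim]) auto
  qed
  have quotient_eq: "\<forall>\<^sub>F s in ?f. partial_x a b F (\<xi> s) (u s) (v s)
        + partial_y F t (\<eta> s) (v s) * ((u s - u t) / (s - t))
        + partial_z F t (u t) (\<zeta> s) * ((v s - v t) / (s - t))
      = (F s (u s) (v s) - F t (u t) (v t)) / (s - t)"
    using ev
  proof eventually_elim
    case (elim s)
    have "F s (u s) (v s) - F t (u t) (v t) = partial_x a b F (\<xi> s) (u s) (v s) * (s - t)
        + partial_y F t (\<eta> s) (v s) * (u s - u t) + partial_z F t (u t) (\<zeta> s) * (v s - v t)"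
      using \<xi>[rule_format, of s] \<eta>[rule_format, of s] \<zeta>[rule_format, of s] elim by linarith
    then show ?case unfolding \<open>F s (u s) (v s) - F t (u t) (v t) = _\<close> add_divide_distrib
      using elim by simp
  qed
  show ?thesis
    unfolding has_field_derivative_iff
    by (rule Lim_transform_eventually[OF quotient_lim quotient_eq])
qed

text \<open>
  The step \<open>(h, k)\<close> is made in \<open>z\<close> first and in \<open>y\<close> afterwards, each time with the one-variable Taylor
  formula; the coefficient \<open>f\<^sub>y(u, v + k)\<close> that appears is expanded in \<open>z\<close> by the mean value theorem.
  In this order the mixed derivative that occurs is \<open>partial_z (partial_y f)\<close>, the one whose total
  derivative along the curve enters the second variation.
\<close>

lemma taylor_lower_bound_near_curve:
  fixes f :: "real \<Rightarrow> real \<Rightarrow> real \<Rightarrow> real"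
  assumes f: "Ck_slab 2 a b f" and u: "continuous_on {a..b} u" and v: "continuous_on {a..b} v"
    and "\<epsilon> > 0"
  shows "\<exists>\<delta>>0. \<forall>x\<in>{a..b}. \<forall>h k. \<bar>h\<bar> < \<delta> \<and> \<bar>k\<bar> < \<delta> \<longrightarrow>
     f x (u x) (v x) + partial_y f x (u x) (v x) * h + partial_z f x (u x) (v x) * k
       + (partial_y (partial_y f) x (u x) (v x) * h\<^sup>2
          + 2 * partial_z (partial_y f) x (u x) (v x) * h * k
          + partial_z (partial_z f) x (u x) (v x) * k\<^sup>2) / 2 - \<epsilon> * (h\<^sup>2 + k\<^sup>2)
     \<le> f x (u x + h) (v x + k)"
proof -
  have f2: "Ck_slab (Suc (Suc 0)) a b f" using f by (simp add: numeral_2_eq_2)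
  then have fy: "Ck_slab (Suc 0) a b (partial_y f)" and fz: "Ck_slab (Suc 0) a b (partial_z f)"
    by auto
  have C: "Ck_slab 0 a b (partial_y (partial_y f))" "Ck_slab 0 a b (partial_z (partial_y f))"
    "Ck_slab 0 a b (partial_z (partial_z f))"
    using fy fz by auto
  note near = uniform_continuity_near_curve[OF slab_continuous u v \<open>\<epsilon> > 0\<close>]
  obtain d1 where d1: "d1 > 0" "\<And>x y z. x \<in> {a..b} \<Longrightarrow> \<bar>y - u x\<bar> < d1 \<Longrightarrow> \<bar>z - v x\<bar> < d1 \<Longrightarrow>
      \<bar>partial_y (partial_y f) x y z - partial_y (partial_y f) x (u x) (v x)\<bar> < \<epsilon>"
    using near[OF C(1)] by metis
  obtain d2 where d2: "d2 > 0" "\<And>x y z. x \<in> {a..b} \<Longrightarrow> \<bar>y - u x\<bar> < d2 \<Longrightarrow> \<bar>z - v x\<bar> < d2 \<Longrightarrow>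
      \<bar>partial_z (partial_y f) x y z - partial_z (partial_y f) x (u x) (v x)\<bar> < \<epsilon>"
    using near[OF C(2)] by metis
  obtain d3 where d3: "d3 > 0" "\<And>x y z. x \<in> {a..b} \<Longrightarrow> \<bar>y - u x\<bar> < d3 \<Longrightarrow> \<bar>z - v x\<bar> < d3 \<Longrightarrow>
      \<bar>partial_z (partial_z f) x y z - partial_z (partial_z f) x (u x) (v x)\<bar> < \<epsilon>"
    using near[OF C(3)] by metis
  let ?\<delta> = "min d1 (min d2 d3)"
  have bound: "f x (u x) (v x) + partial_y f x (u x) (v x) * h + partial_z f x (u x) (v x) * k
       + (partial_y (partial_y f) x (u x) (v x) * h\<^sup>2
          + 2 * partial_z (partial_y f) x (u x) (v x) * h * k
          + partial_z (partial_z f) x (u x) (v x) * k\<^sup>2) / 2 - \<epsilon> * (h\<^sup>2 + k\<^sup>2)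
     \<le> f x (u x + h) (v x + k)"
    if x: "x \<in> {a..b}" and h: "\<bar>h\<bar> < ?\<delta>" and k: "\<bar>k\<bar> < ?\<delta>" for x h k
  proof -
    note D = slab_partial_derivatives[OF f2 x] slab_partial_derivatives[OF fy x]
      slab_partial_derivatives[OF fz x]
    obtain r where r: "\<bar>r - u x\<bar> \<le> \<bar>h\<bar>" and r_eq: "f x (u x + h) (v x + k) = f x (u x) (v x + k)
        + partial_y f x (u x) (v x + k) * h + partial_y (partial_y f) x r (v x + k) / 2 * h\<^sup>2"
      using taylor_order2[OF D(2) D(5)] by metis
    obtain s where s: "\<bar>s - v x\<bar> \<le> \<bar>k\<bar>" and s_eq: "f x (u x) (v x + k) = f x (u x) (v x)
        + partial_z f x (u x) (v x) * k + partial_z (partial_z f) x (u x) s / 2 * k\<^sup>2"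
      using taylor_order2[OF D(3) D(9)] by metis
    have "\<exists>m\<in>UNIV. \<bar>m - v x\<bar> \<le> \<bar>v x + k - v x\<bar> \<and> partial_y f x (u x) (v x + k) - partial_y f x (u x) (v x)
        = partial_z (partial_y f) x (u x) m * (v x + k - v x)"
      by (rule mvt_convex) (auto intro: D)
    then obtain m where m: "\<bar>m - v x\<bar> \<le> \<bar>k\<bar>" and m_eq: "partial_y f x (u x) (v x + k)
        = partial_y f x (u x) (v x) + partial_z (partial_y f) x (u x) m * k"
      by (auto simp: algebra_simps)
    \<comment> \<open>The deviations of the second derivatives at the intermediate points from their values on the curve.\<close>
    define A where "A = partial_y (partial_y f) x r (v x + k) - partial_y (partial_y f) x (u x) (v x)"
    define B where "B = partial_z (partial_y f) x (u x) m - partial_z (partial_y f) x (u x) (v x)"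
    define E where "E = partial_z (partial_z f) x (u x) s - partial_z (partial_z f) x (u x) (v x)"
    have "\<bar>A\<bar> < \<epsilon>" unfolding A_def using x h k r by (intro d1(2)) auto
    then have A: "- \<epsilon> * h\<^sup>2 \<le> A * h\<^sup>2" by (intro mult_right_mono) auto
    have "\<bar>B\<bar> < \<epsilon>" unfolding B_def using x h k m d2(1) by (intro d2(2)) auto
    then have "\<bar>B * (h * k)\<bar> \<le> \<epsilon> * \<bar>h * k\<bar>"
      unfolding abs_mult[of B] by (intro mult_right_mono) auto
    moreover have "\<epsilon> * (2 * \<bar>h * k\<bar>) \<le> \<epsilon> * (h\<^sup>2 + k\<^sup>2)"
      using \<open>\<epsilon> > 0\<close> sum_squares_bound[of "\<bar>h\<bar>" "\<bar>k\<bar>"]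
      by (intro mult_left_mono) (auto simp: abs_mult)
    ultimately have B: "- \<epsilon> * (h\<^sup>2 + k\<^sup>2) / 2 \<le> B * (h * k)" by linarith
    have "\<bar>E\<bar> < \<epsilon>" unfolding E_def using x h k s d3(1) by (intro d3(2)) auto
    then have E: "- \<epsilon> * k\<^sup>2 \<le> E * k\<^sup>2" by (intro mult_right_mono) auto
    have "f x (u x + h) (v x + k) = f x (u x) (v x) + partial_y f x (u x) (v x) * h
       + partial_z f x (u x) (v x) * k
       + (partial_y (partial_y f) x (u x) (v x) * h\<^sup>2
          + 2 * partial_z (partial_y f) x (u x) (v x) * h * k
          + partial_z (partial_z f) x (u x) (v x) * k\<^sup>2) / 2
       + (A * h\<^sup>2 / 2 + B * (h * k) + E * k\<^sup>2 / 2)"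
      unfolding r_eq s_eq m_eq A_def B_def E_def by (simp add: field_simps power2_eq_square)
    moreover have "- \<epsilon> * (h\<^sup>2 + k\<^sup>2) \<le> A * h\<^sup>2 / 2 + B * (h * k) + E * k\<^sup>2 / 2"
      using A B E by (simp add: algebra_simps)
    ultimately show ?thesis by linarith
  qed
  have "0 < ?\<delta>" using d1(1) d2(1) d3(1) by simp
  with bound show ?thesis by blast
qed

section \<open>Integral inequalities\<close>

lemma has_integral_total_derivative:
  fixes g h :: "real \<Rightarrow> real"
  assumes "a \<le> b"
    and "\<And>x. x \<in> {a..b} \<Longrightarrow> (g has_real_derivative g' x) (at x within {a..b})"
    and "\<And>x. x \<in> {a..b} \<Longrightarrow> (h has_real_derivative h' x) (at x within {a..b})"
    and "h a = 0" "h b = 0"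
  shows "((\<lambda>x. g' x * h x + g x * h' x) has_integral 0) {a..b}"
proof -
  have "((\<lambda>x. g' x * h x + g x * h' x) has_integral (g b * h b - g a * h a)) {a..b}"
  proof (rule fundamental_theorem_of_calculus[OF assms(1)])
    fix x assume x: "x \<in> {a..b}"
    show "((\<lambda>x. g x * h x) has_vector_derivative g' x * h x + g x * h' x) (at x within {a..b})"
      unfolding has_real_derivative_iff_has_vector_derivative[symmetric]
      using DERIV_mult[OF assms(2)[OF x] assms(3)[OF x]] by (simp add: algebra_simps)
  qed
  then show ?thesis using assms by simp
qed

text \<open>
  Jacobi's device: for any \<open>w\<close>, \<open>0 \<le> (h' - w h)\<^sup>2 = h'\<^sup>2 + (w' + w\<^sup>2) h\<^sup>2 - (w h\<^sup>2)'\<close>, and the last term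
  integrates to zero. The function \<open>w\<close> below solves the Riccati equation \<open>w' + w\<^sup>2 = - c\<^sup>2\<close>; its pole-free
  interval, centred at the midpoint of \<open>[a, b]\<close>, has length \<open>\<pi> / c\<close>, whence the condition on \<open>c\<close>.
\<close>

lemma wirtinger:
  fixes h h' :: "real \<Rightarrow> real"
  assumes ab: "a < b" and c: "0 < c" "c * (b - a) < pi"
    and h: "\<And>x. x \<in> {a..b} \<Longrightarrow> (h has_real_derivative h' x) (at x within {a..b})"
    and h': "continuous_on {a..b} h'"
    and bd: "h a = 0" "h b = 0"
  shows "c\<^sup>2 * integral {a..b} (\<lambda>x. (h x)\<^sup>2) \<le> integral {a..b} (\<lambda>x. (h' x)\<^sup>2)"
proof -
  define w where "w = (\<lambda>x. - c * tan (c * (x - (a + b) / 2)))"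
  define w' where "w' = (\<lambda>x. - c * (c * (1 + (tan (c * (x - (a + b) / 2)))\<^sup>2)))"
  have h_cont: "continuous_on {a..b} h"
    by (rule DERIV_continuous_on[OF h])
  have w_deriv: "(w has_real_derivative w' x) (at x within {a..b})" if x: "x \<in> {a..b}" for x
  proof -
    have "\<bar>x - (a + b) / 2\<bar> \<le> (b - a) / 2"
      using x by (auto simp: abs_le_iff field_simps)
    then have "\<bar>c * (x - (a + b) / 2)\<bar> \<le> c * ((b - a) / 2)"
      using c by (simp add: abs_mult mult_left_mono)
    also have "\<dots> < pi / 2" using c by simp
    finally have "cos (c * (x - (a + b) / 2)) > 0"
      by (intro cos_gt_zero_pi) auto
    then have cos: "cos (c * (x - (a + b) / 2)) \<noteq> 0" by simp
    have "1 + (tan (c * (x - (a + b) / 2)))\<^sup>2 = inverse ((cos (c * (x - (a + b) / 2)))\<^sup>2)"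
      using tan_sec[OF cos] by (simp add: power_inverse)
    then have eq: "w' x = - c * (inverse ((cos (c * (x - (a + b) / 2)))\<^sup>2) * c)"
      unfolding w'_def by simp
    have "(w has_real_derivative - c * (inverse ((cos (c * (x - (a + b) / 2)))\<^sup>2) * c)) (at x)"
      unfolding w_def
      by (intro DERIV_cmult DERIV_chain2[where f = tan and g = "\<lambda>x. c * (x - (a + b) / 2)"]
          DERIV_tan[OF cos]) (auto intro!: derivative_eq_intros)
    then show ?thesis unfolding eq by (rule has_field_derivative_at_within)
  qed
  have h2: "((\<lambda>x. (h x)\<^sup>2) has_real_derivative 2 * h x * h' x) (at x within {a..b})"
    if "x \<in> {a..b}" for x
    using h[OF that] by (auto intro!: derivative_eq_intros)
  have T: "((\<lambda>x. w' x * (h x)\<^sup>2 + w x * (2 * h x * h' x)) has_integral 0) {a..b}"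
    using ab w_deriv h2 bd by (intro has_integral_total_derivative) auto
  have I: "((\<lambda>x. (h' x)\<^sup>2 - c\<^sup>2 * (h x)\<^sup>2) has_integral
      integral {a..b} (\<lambda>x. (h' x)\<^sup>2) - c\<^sup>2 * integral {a..b} (\<lambda>x. (h x)\<^sup>2)) {a..b}"
    by (intro has_integral_diff has_integral_mult_right integrable_integral
        integrable_continuous_real continuous_intros h_cont h')
  have "0 \<le> integral {a..b} (\<lambda>x. (h' x)\<^sup>2) - c\<^sup>2 * integral {a..b} (\<lambda>x. (h x)\<^sup>2)"
  proof (rule has_integral_le[OF T I])
    fix x
    have "0 \<le> (h' x - w x * h x)\<^sup>2" by simp
    moreover have riccati: "w' x = - c\<^sup>2 - (w x)\<^sup>2"
      unfolding w_def w'_def by (simp add: algebra_simps power2_eq_square)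
    ultimately show "w' x * (h x)\<^sup>2 + w x * (2 * h x * h' x) \<le> (h' x)\<^sup>2 - c\<^sup>2 * (h x)\<^sup>2"
      unfolding riccati by (simp add: algebra_simps power2_eq_square)
  qed
  then show ?thesis by simp
qed

section \<open>Sufficient condition for a strict local minimum\<close>

text \<open>
  The condition \<open>p c\<^sup>2 + q > 0\<close> makes the quadratic form \<open>\<integral> q h\<^sup>2 + p h'\<^sup>2\<close> coercive: a small part of
  \<open>p h'\<^sup>2\<close> is reserved, and Wirtinger's inequality spends the rest on compensating a negative \<open>q\<close>.
  Both cases of the theorem are instances of this statement.
\<close>

lemma strong_local_min_if_coercive:
  fixes a b c p q :: real
    and f :: "real \<Rightarrow> real \<Rightarrow> real \<Rightarrow> real"
    and y0 :: "real \<Rightarrow> real"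
  assumes ab: "a < b"
    and f: "Ck_slab 2 a b f"
    and fyz: "Ck_slab 1 a b (partial_z (partial_y f))"
    and y0: "Ck_interval 2 a b y0"
    and EL: "\<forall>x\<in>{a..b}.
           partial_y f x (y0 x) (ddx a b y0 x)
             - ddx a b (\<lambda>t. partial_z f t (y0 t) (ddx a b y0 t)) x = 0"
    and p: "p = min_on a b (\<lambda>x. partial_z (partial_z f) x (y0 x) (ddx a b y0 x))"
    and q: "q = min_on a b (\<lambda>x.
           partial_y (partial_y f) x (y0 x) (ddx a b y0 x)
             - ddx a b (\<lambda>t. partial_z (partial_y f) t (y0 t) (ddx a b y0 t)) x)"
    and c: "0 < c" "c * (b - a) < pi"
    and pos: "0 < p" "0 < p * c\<^sup>2 + q"
  shows "strong_local_min a b (functional a b f) y0"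
proof -
  define z0 where "z0 = ddx a b y0"
  have f2: "Ck_slab (Suc (Suc 0)) a b f" using f by (simp add: numeral_2_eq_2)
  then have fy1: "Ck_slab 1 a b (partial_y f)" and fz1: "Ck_slab 1 a b (partial_z f)"
    by auto
  have y0_deriv: "(y0 has_real_derivative z0 x) (at x within {a..b})"
    and z0_deriv: "(z0 has_real_derivative ddx a b z0 x) (at x within {a..b})"
    if "x \<in> {a..b}" for x
    using y0 that by (auto simp: numeral_2_eq_2 z0_def differentiable_on_def intro!: has_ddx)
  have y0_cont: "continuous_on {a..b} y0" by (rule DERIV_continuous_on[OF y0_deriv])
  have z0_cont: "continuous_on {a..b} z0" by (rule DERIV_continuous_on[OF z0_deriv])
  have z0'_cont: "continuous_on {a..b} (ddx a b z0)"
    using y0 by (simp add: numeral_2_eq_2 z0_def)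
  note along = continuous_on_slab_curve[OF slab_continuous[where k = 0] y0_cont z0_cont]

  define G where "G = (\<lambda>x. partial_z f x (y0 x) (z0 x))"
  define F where "F = (\<lambda>x. partial_z (partial_y f) x (y0 x) (z0 x))"
  define P where "P = (\<lambda>x. partial_z (partial_z f) x (y0 x) (z0 x))"
  define Q where "Q = (\<lambda>x. partial_y (partial_y f) x (y0 x) (z0 x) - ddx a b F x)"
  have G_deriv: "(G has_real_derivative partial_y f x (y0 x) (z0 x)) (at x within {a..b})"
    if x: "x \<in> {a..b}" for x
  proof -
    have "G differentiable (at x within {a..b})"
      unfolding G_def using chain_rule_slab[OF fz1 x y0_deriv[OF x] z0_deriv[OF x]]
      by (auto simp: real_differentiable_def)
    from has_ddx[OF this] show ?thesis using EL x by (simp add: G_def z0_def)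
  qed
  have F_chain: "(F has_real_derivative
      partial_x a b (partial_z (partial_y f)) x (y0 x) (z0 x)
      + partial_y (partial_z (partial_y f)) x (y0 x) (z0 x) * z0 x
      + partial_z (partial_z (partial_y f)) x (y0 x) (z0 x) * ddx a b z0 x) (at x within {a..b})"
    if x: "x \<in> {a..b}" for x
    unfolding F_def by (rule chain_rule_slab[OF fyz x y0_deriv[OF x] z0_deriv[OF x]])
  have F_deriv: "(F has_real_derivative ddx a b F x) (at x within {a..b})"
    if x: "x \<in> {a..b}" for x
    using F_chain[OF x] ddx_eqI[OF ab x F_chain[OF x]] by simp
  \<comment> \<open>Continuity of \<open>Q\<close> is what makes \<open>q\<close> an attained minimum, hence a lower bound; it rests on the
    explicit formula for the derivative of \<open>F\<close>.\<close>
  have F'_cont: "continuous_on {a..b} (ddx a b F)"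
  proof -
    have "continuous_on {a..b} (\<lambda>x. partial_x a b (partial_z (partial_y f)) x (y0 x) (z0 x)
      + partial_y (partial_z (partial_y f)) x (y0 x) (z0 x) * z0 x
      + partial_z (partial_z (partial_y f)) x (y0 x) (z0 x) * ddx a b z0 x)"
      using fyz
      by (intro continuous_on_add continuous_on_mult z0_cont z0'_cont
          along[where F = "partial_x a b (partial_z (partial_y f))"]
          along[where F = "partial_y (partial_z (partial_y f))"]
          along[where F = "partial_z (partial_z (partial_y f))"]) auto
    then show ?thesis
      by (rule continuous_on_eq) (use ddx_eqI[OF ab _ F_chain] in simp)
  qed
  have "continuous_on {a..b} P"
    unfolding P_def using fz1 by (intro along[where F = "partial_z (partial_z f)"]) auto
  then have P_ge: "p \<le> P x" if "x \<in> {a..b}" for x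
    using min_on_le[OF _ that, of P] p by (simp add: P_def z0_def)
  have "continuous_on {a..b} Q"
    unfolding Q_def using fy1
    by (intro continuous_on_diff F'_cont along[where F = "partial_y (partial_y f)"]) auto
  then have Q_ge: "q \<le> Q x" if "x \<in> {a..b}" for x
    using min_on_le[OF _ that, of Q] q by (simp add: Q_def F_def z0_def)

  \<comment> \<open>The coercivity constant: the largest \<open>\<kappa> \<le> p\<close> for which
    \<open>(p - \<kappa>) c\<^sup>2 + (q - \<kappa>) \<ge> 0\<close>. The Taylor error is then allowed half of the gain \<open>\<kappa> / 2\<close>.\<close>
  define \<kappa> where "\<kappa> = min p ((p * c\<^sup>2 + q) / (1 + c\<^sup>2))"
  have c2: "0 < 1 + c\<^sup>2" using c by (simp add: add_pos_nonneg)
  have "0 < \<kappa>" "\<kappa> \<le> p" using pos c2 by (auto simp: \<kappa>_def)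
  moreover have "\<kappa> \<le> (p * c\<^sup>2 + q) / (1 + c\<^sup>2)" by (simp add: \<kappa>_def)
  then have "\<kappa> * (1 + c\<^sup>2) \<le> p * c\<^sup>2 + q" using c2 by (simp only: pos_le_divide_eq)
  ultimately have \<kappa>: "0 < \<kappa>" "\<kappa> \<le> p" "\<kappa> * (1 + c\<^sup>2) \<le> p * c\<^sup>2 + q" by auto
  obtain \<delta> where \<delta>: "\<delta> > 0" and taylor: "\<And>x h k. x \<in> {a..b} \<Longrightarrow> \<bar>h\<bar> < \<delta> \<Longrightarrow> \<bar>k\<bar> < \<delta> \<Longrightarrow>
      f x (y0 x) (z0 x) + partial_y f x (y0 x) (z0 x) * h + partial_z f x (y0 x) (z0 x) * k
       + (partial_y (partial_y f) x (y0 x) (z0 x) * h\<^sup>2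
          + 2 * partial_z (partial_y f) x (y0 x) (z0 x) * h * k
          + partial_z (partial_z f) x (y0 x) (z0 x) * k\<^sup>2) / 2 - \<kappa> / 4 * (h\<^sup>2 + k\<^sup>2)
     \<le> f x (y0 x + h) (z0 x + k)"
    using taylor_lower_bound_near_curve[OF f y0_cont z0_cont, of "\<kappa> / 4"] \<kappa>(1) by auto

  have "functional a b f y0 < functional a b f y"
    if y: "Ck_interval 1 a b y" and bd: "y a = y0 a" "y b = y0 b"
      and ne: "\<exists>x\<in>{a..b}. y x \<noteq> y0 x" and close: "C1_norm a b (\<lambda>x. y x - y0 x) < \<delta>" for y
  proof -
    define z where "z = ddx a b y"
    define h where "h = (\<lambda>x. y x - y0 x)"
    define h' where "h' = (\<lambda>x. z x - z0 x)"
    have y_deriv: "(y has_real_derivative z x) (at x within {a..b})" if "x \<in> {a..b}" for x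
      using y that by (auto simp: z_def differentiable_on_def intro!: has_ddx)
    have y_cont: "continuous_on {a..b} y" by (rule DERIV_continuous_on[OF y_deriv])
    have z_cont: "continuous_on {a..b} z" using y by (simp add: z_def)
    have h_deriv: "(h has_real_derivative h' x) (at x within {a..b})" if "x \<in> {a..b}" for x
      unfolding h_def h'_def by (intro DERIV_diff y_deriv y0_deriv that)
    have h_cont: "continuous_on {a..b} h" and h'_cont: "continuous_on {a..b} h'"
      unfolding h_def h'_def by (intro continuous_intros y_cont z_cont y0_cont z0_cont)+
    have ddx_h: "ddx a b h x = h' x" if "x \<in> {a..b}" for x
      by (rule ddx_eqI[OF ab that h_deriv[OF that]])
    have "continuous_on {a..b} (ddx a b h)"
      using h'_cont by (rule continuous_on_eq) (use ddx_h in simp)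
    note norm = C1_norm_bounds[OF h_cont this]
    have small: "\<bar>h x\<bar> < \<delta>" "\<bar>h' x\<bar> < \<delta>" if "x \<in> {a..b}" for x
      using norm[OF that] close ddx_h[OF that] by (simp_all add: h_def)
    have h0: "h a = 0" "h b = 0" using bd by (simp_all add: h_def)

    define H where "H = integral {a..b} (\<lambda>x. (h x)\<^sup>2)"
    define D where "D = integral {a..b} (\<lambda>x. (h' x)\<^sup>2)"
    have H_int: "((\<lambda>x. (h x)\<^sup>2) has_integral H) {a..b}"
      unfolding H_def by (intro integrable_integral integrable_continuous_real continuous_intros h_cont)
    have D_int: "((\<lambda>x. (h' x)\<^sup>2) has_integral D) {a..b}"
      unfolding D_def by (intro integrable_integral integrable_continuous_real continuous_intros h'_cont)
    have D_ge0: "0 \<le> D" using has_integral_nonneg[OF D_int] by simp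
    have "0 \<le> H" using has_integral_nonneg[OF H_int] by simp
    moreover have "H \<noteq> 0"
    proof
      assume "H = 0"
      then have "\<forall>x\<in>{a..b}. (h x)\<^sup>2 = 0"
        unfolding H_def using ab
        by (subst (asm) integral_eq_0_iff) (auto intro!: continuous_intros h_cont)
      with ne show False by (auto simp: h_def)
    qed
    ultimately have H_pos: "0 < H" by simp
    have wirt: "c\<^sup>2 * H \<le> D"
      unfolding H_def D_def by (rule wirtinger[OF ab c h_deriv h'_cont h0])
    have coercive: "\<kappa> * (H + D) \<le> q * H + p * D"
    proof -
      have "(p - \<kappa>) * (c\<^sup>2 * H) \<le> (p - \<kappa>) * D" using \<kappa>(2) wirt by (intro mult_left_mono) auto
      moreover have "\<kappa> * (1 + c\<^sup>2) * H \<le> (p * c\<^sup>2 + q) * H"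
        using \<kappa>(3) H_pos by (intro mult_right_mono) auto
      ultimately show ?thesis by (simp add: algebra_simps)
    qed

    have first: "((\<lambda>x. partial_y f x (y0 x) (z0 x) * h x + G x * h' x) has_integral 0) {a..b}"
      using ab by (intro has_integral_total_derivative G_deriv h_deriv h0) auto
    have h2: "((\<lambda>x. (h x)\<^sup>2) has_real_derivative 2 * h x * h' x) (at x within {a..b})"
      if "x \<in> {a..b}" for x
      using h_deriv[OF that] by (auto intro!: derivative_eq_intros)
    have mixed: "((\<lambda>x. ddx a b F x * (h x)\<^sup>2 + F x * (2 * h x * h' x)) has_integral 0) {a..b}"
      using ab h0 by (intro has_integral_total_derivative F_deriv h2) auto
    have int0: "((\<lambda>x. f x (y0 x) (z0 x)) has_integral functional a b f y0) {a..b}"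
      unfolding functional_def z0_def[symmetric]
      by (intro integrable_integral integrable_continuous_real
          continuous_on_slab_curve[OF slab_continuous[OF f] y0_cont z0_cont])
    have int1: "((\<lambda>x. f x (y x) (z x)) has_integral functional a b f y) {a..b}"
      unfolding functional_def z_def[symmetric]
      by (intro integrable_integral integrable_continuous_real
          continuous_on_slab_curve[OF slab_continuous[OF f] y_cont z_cont])
    \<comment> \<open>The pointwise minorant of the integrand, arranged so that everything except the zeroth order
      term and the final quadratic form is a total derivative that integrates to zero.\<close>
    have lower: "((\<lambda>x. f x (y0 x) (z0 x) + (partial_y f x (y0 x) (z0 x) * h x + G x * h' x)
          + (ddx a b F x * (h x)\<^sup>2 + F x * (2 * h x * h' x)) / 2
          + ((q / 2 - \<kappa> / 4) * (h x)\<^sup>2 + (p / 2 - \<kappa> / 4) * (h' x)\<^sup>2)) has_integral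
        functional a b f y0 + 0 + 0 / 2 + ((q / 2 - \<kappa> / 4) * H + (p / 2 - \<kappa> / 4) * D)) {a..b}"
      by (intro has_integral_add has_integral_divide has_integral_mult_right
          int0 first mixed H_int D_int)
    have "functional a b f y0 + 0 + 0 / 2 + ((q / 2 - \<kappa> / 4) * H + (p / 2 - \<kappa> / 4) * D)
        \<le> functional a b f y"
    proof (rule has_integral_le[OF lower int1])
      fix x assume x: "x \<in> {a..b}"
      have "q * (h x)\<^sup>2 \<le> Q x * (h x)\<^sup>2" "p * (h' x)\<^sup>2 \<le> P x * (h' x)\<^sup>2"
        using P_ge[OF x] Q_ge[OF x] by (auto intro: mult_right_mono)
      moreover have "f x (y0 x + h x) (z0 x + h' x) = f x (y x) (z x)"
        by (simp add: h_def h'_def)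
      ultimately show "f x (y0 x) (z0 x) + (partial_y f x (y0 x) (z0 x) * h x + G x * h' x)
          + (ddx a b F x * (h x)\<^sup>2 + F x * (2 * h x * h' x)) / 2
          + ((q / 2 - \<kappa> / 4) * (h x)\<^sup>2 + (p / 2 - \<kappa> / 4) * (h' x)\<^sup>2) \<le> f x (y x) (z x)"
        using taylor[OF x small[OF x]]
        unfolding Q_def P_def F_def[symmetric] G_def[symmetric]
        by (simp add: F_def G_def field_simps)
    qed
    moreover have "0 < \<kappa> / 4 * (H + D)" using \<kappa>(1) H_pos D_ge0 by simp
    ultimately show ?thesis using coercive by (simp add: algebra_simps)
  qed
  then show ?thesis unfolding strong_local_min_def using \<delta> by blast
qed

theorem theorem4p1:
  fixes a b p q :: real
    and f :: "real \<Rightarrow> real \<Rightarrow> real \<Rightarrow> real"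
    and y0 :: "real \<Rightarrow> real"
  assumes "a < b"
    and "Ck_slab 2 a b f"
    and "Ck_slab 1 a b (partial_z (partial_y f))"
    and "Ck_interval 2 a b y0"
    and "\<forall>x\<in>{a..b}.
           partial_y f x (y0 x) (ddx a b y0 x)
             - ddx a b (\<lambda>t. partial_z f t (y0 t) (ddx a b y0 t)) x = 0"
    and "p = min_on a b (\<lambda>x. partial_z (partial_z f) x (y0 x) (ddx a b y0 x))"
    and "q = min_on a b (\<lambda>x.
           partial_y (partial_y f) x (y0 x) (ddx a b y0 x)
             - ddx a b (\<lambda>t. partial_z (partial_y f) t (y0 t) (ddx a b y0 t)) x)"
  shows "(p > 0 \<and> q \<ge> 0 \<longrightarrow> strong_local_min a b (functional a b f) y0) \<and>
         (p > 0 \<and> q < 0 \<and> b - a < pi / 4 * sqrt (p / \<bar>q\<bar>) \<longrightarrow>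
           strong_local_min a b (functional a b f) y0)"
proof -
  \<comment> \<open>With this \<open>c\<close>, the bound on \<open>b - a\<close> in the second case says precisely that \<open>\<bar>q\<bar> < p c\<^sup>2\<close>.\<close>
  define c where "c = pi / 4 / (b - a)"
  have c_ba: "c * (b - a) = pi / 4" using \<open>a < b\<close> by (simp add: c_def field_simps)
  have c: "0 < c" "c * (b - a) < pi"
    using \<open>a < b\<close> c_ba pi_gt_zero by (simp add: c_def, linarith)
  note min = strong_local_min_if_coercive[OF assms c]
  have "0 < p * c\<^sup>2 + q" if "p > 0" "q \<ge> 0"
    using that c by (simp add: add_pos_nonneg)
  moreover have "0 < p * c\<^sup>2 + q" if "p > 0" "q < 0" "b - a < pi / 4 * sqrt (p / \<bar>q\<bar>)"
  proof -
    have "b - a < c * (b - a) * sqrt (p / \<bar>q\<bar>)" unfolding c_ba by (rule that(3))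
    then have "1 * (b - a) < (c * sqrt (p / \<bar>q\<bar>)) * (b - a)" by (simp add: mult_ac)
    then have "1 < c * sqrt (p / \<bar>q\<bar>)"
      using \<open>a < b\<close> by (simp only: mult_less_cancel_right_pos diff_gt_0_iff_gt)
    then have "1 < (c * sqrt (p / \<bar>q\<bar>))\<^sup>2" by (rule one_less_power) simp
    moreover have "(sqrt (p / \<bar>q\<bar>))\<^sup>2 = p / \<bar>q\<bar>" using that(1) by (intro real_sqrt_pow2) simp
    ultimately have "1 < c\<^sup>2 * p / \<bar>q\<bar>" by (simp only: power_mult_distrib times_divide_eq_right)
    then have "\<bar>q\<bar> < c\<^sup>2 * p" using that(2) by (simp only: less_divide_eq_1_pos zero_less_abs_iff)
    then show ?thesis using that(2) by (simp add: mult.commute)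
  qed
  ultimately show ?thesis using min by blast
qed

end
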